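(* Let $C$ be a circle of unit radius in the plane centered at $c$, and let $\gamma$ be a circular arc of $C$ subtending a central angle less than $\pi/3$. Let $X$ consist of $c$ together with a set of $n-1$ equidistant points on $\gamma$. Then $a(X)=(n-1,n-2,\ldots,1)$.
   Context: Points on an arc are equidistant if, listed in order along the arc, consecutive points are separated by the same positive arc length. For a finite set $X\subseteq\mathbb{R}^2$ determining $m$ distinct Euclidean distances between its points, the multiplicity of a distance is the number of unordered pairs of distinct points of $X$ at that distance, and $a(X)=(a_1(X),\dots,a_m(X))$ is the list of the multiplicities of all $m$ distances in non-increasing order $a_1(X)\geq\cdots\geq a_m(X)$. *)

theory Defs
  imports "HOL-Analysis.Analysis" "HOL-Library.Multiset"
begin

definition circle_point :: "real^2 \<Rightarrow> real \<Rightarrow> real \<Rightarrow> real^2" where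
  "circle_point c r t = c + r *\<^sub>R vector [cos t, sin t]"

text \<open>
  The closed arc of \<open>sphere c r\<close> from polar angle \<open>\<alpha>\<close> counterclockwise to
  polar angle \<open>\<beta>\<close>; for \<open>\<alpha> \<le> \<beta> \<le> \<alpha> + 2 * pi\<close> it subtends the central angle
  \<open>\<beta> - \<alpha>\<close>.
\<close>

definition circular_arc :: "real^2 \<Rightarrow> real \<Rightarrow> real \<Rightarrow> real \<Rightarrow> (real^2) set" where
  "circular_arc c r \<alpha> \<beta> = circle_point c r ` {\<alpha>..\<beta>}"

definition arc_length :: "(real \<Rightarrow> 'a::euclidean_space) \<Rightarrow> real \<Rightarrow> real \<Rightarrow> real" where
  "arc_length g s t = integral {s..t} (\<lambda>u. norm (vector_derivative g (at u)))"

text \<open>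
  The list \<open>ts\<close> gives the polar angles of the points of \<open>P\<close> in the order in which
  they occur along the arc. The definition is meant for arcs that are not full
  circles, \<open>\<beta> - \<alpha> < 2 * pi\<close>, where each point of the arc has exactly one angle in
  \<open>{\<alpha>..\<beta>}\<close>. Sets of at most one point are equidistant, having no consecutive points.
\<close>

definition equidistant_on_arc ::
    "real^2 \<Rightarrow> real \<Rightarrow> real \<Rightarrow> real \<Rightarrow> (real^2) set \<Rightarrow> bool" where
  "equidistant_on_arc c r \<alpha> \<beta> P \<longleftrightarrow>
     (\<exists>ts L. sorted_wrt (<) ts \<and> set ts \<subseteq> {\<alpha>..\<beta>} \<and> P = circle_point c r ` set ts \<and> L > 0 \<and>
       (\<forall>i. Suc i < length ts \<longrightarrow> arc_length (circle_point c r) (ts ! i) (ts ! Suc i) = L))"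

definition distances :: "'a::metric_space set \<Rightarrow> real set" where
  "distances X = {dist x y | x y. x \<in> X \<and> y \<in> X \<and> x \<noteq> y}"

definition distance_multiplicity :: "'a::metric_space set \<Rightarrow> real \<Rightarrow> nat" where
  "distance_multiplicity X d =
     card {{x, y} | x y. x \<in> X \<and> y \<in> X \<and> x \<noteq> y \<and> dist x y = d}"

text \<open>
  The list \<open>a(X)\<close>: one entry for each distance (equal multiplicities are repeated), in
  non-increasing order. It is meaningful for finite \<open>X\<close> only.
\<close>

definition distance_multiplicities :: "'a::metric_space set \<Rightarrow> nat list" where
  "distance_multiplicities X =
     rev (sorted_list_of_multiset
       (image_mset (distance_multiplicity X) (mset_set (distances X))))"

end

theory Submission
  imports Defs
begin

text \<open>
  Number the centre \<open>0\<close> and the points of the arc \<open>1, \<dots>, m\<close>, in order. The pairs \<open>(0, j)\<close>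
  are at distance \<open>1\<close>, and the pairs \<open>(i, i + k)\<close> with \<open>i \<ge> 1\<close> at distance
  \<open>2 * sin (k * L / 2)\<close>, where \<open>L\<close> is the angle between consecutive points. As the arc
  subtends less than \<open>pi / 3\<close>, these chords increase strictly with \<open>k\<close> and stay below \<open>1\<close>, so
  the distances have multiplicities \<open>m\<close> and \<open>m - k\<close> for \<open>1 \<le> k < m\<close>.
\<close>

section \<open>Arc lengths and chords of a circle\<close>

text \<open>Puts \<open>circle_point\<close> into a form to which the rules for derivatives of sums
  and scalar multiples apply.\<close>

lemma vector_2_eq_axis: "vector [x, y] = x *\<^sub>R axis 1 1 + y *\<^sub>R (axis 2 1 :: real^2)"
  by (simp add: vec_eq_iff forall_2 axis_def)

lemma norm_vector_2: "norm (vector [x, y] :: real^2) = sqrt (x\<^sup>2 + y\<^sup>2)"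
  by (simp add: norm_vec_def L2_set_def sum_2)

lemma has_vector_derivative_circle_point:
  "(circle_point c r has_vector_derivative r *\<^sub>R vector [- sin t, cos t]) (at t)"
proof -
  have "((\<lambda>t. c + r *\<^sub>R (cos t *\<^sub>R axis 1 1 + sin t *\<^sub>R (axis 2 1 :: real^2)))
      has_vector_derivative r *\<^sub>R (- sin t *\<^sub>R axis 1 1 + cos t *\<^sub>R axis 2 1)) (at t)"
    by (auto intro!: derivative_eq_intros simp: has_real_derivative_iff_has_vector_derivative[symmetric])
  then show ?thesis
    by (simp add: circle_point_def[abs_def] vector_2_eq_axis)
qed

lemma arc_length_circle_point:
  assumes "r \<ge> 0" "s \<le> t"
  shows "arc_length (circle_point c r) s t = r * (t - s)"
proof -
  have "norm (vector_derivative (circle_point c r) (at u)) = r" for u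
    using assms by (simp add: vector_derivative_at[OF has_vector_derivative_circle_point]
        norm_vector_2)
  then show ?thesis
    using assms by (simp add: arc_length_def)
qed

lemma dist_circle_point_center: "dist c (circle_point c r t) = \<bar>r\<bar>"
  by (simp add: circle_point_def dist_norm norm_vector_2)

lemma dist_circle_point:
  "dist (circle_point c r s) (circle_point c r t) = \<bar>r\<bar> * (2 * \<bar>sin ((t - s) / 2)\<bar>)"
proof -
  have "(cos s - cos t)\<^sup>2 + (sin s - sin t)\<^sup>2
      = (2 * sin ((t - s) / 2))\<^sup>2 * ((sin ((s + t) / 2))\<^sup>2 + (cos ((s + t) / 2))\<^sup>2)"
  proof -
    \<comment> \<open>Half the difference and the mean of the two angles: sum-to-product pulls the
      factor \<open>2 * sin u\<close> out of both coordinate differences and leaves a unit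
      vector.\<close>
    define u v where "u = (t - s) / 2" and "v = (s + t) / 2"
    have "s = v - u" "t = v + u"
      by (simp_all add: u_def v_def field_simps)
    then have "cos s - cos t = 2 * sin u * sin v" "sin s - sin t = - (2 * sin u * cos v)"
      by (simp_all add: cos_add cos_diff sin_add sin_diff)
    then show ?thesis
      unfolding u_def[symmetric] v_def[symmetric]
      by (simp only: power2_minus power_mult_distrib distrib_left)
  qed
  then have "sqrt ((cos s - cos t)\<^sup>2 + (sin s - sin t)\<^sup>2) = 2 * \<bar>sin ((t - s) / 2)\<bar>"
    by (simp add: real_sqrt_mult)
  moreover have "circle_point c r s - circle_point c r t
      = r *\<^sub>R vector [cos s - cos t, sin s - sin t]"
    by (simp add: circle_point_def vec_eq_iff forall_2 algebra_simps)
  ultimately show ?thesis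
    by (simp add: dist_norm norm_vector_2)
qed

text \<open>On the unit circle arc length is the difference of angles, so the angles form an
  arithmetic progression. Angles \<open>k\<close> steps apart both lie in the interval from \<alpha>
  to \<beta>, which bounds \<open>k * L\<close>.\<close>

lemma equidistant_on_arc_progression:
  assumes "equidistant_on_arc c 1 \<alpha> \<beta> P"
  obtains a L m where "L > 0" "P = (\<lambda>j. circle_point c 1 (a + real j * L)) ` {1..m}"
    "\<And>k. k < m \<Longrightarrow> real k * L \<le> \<beta> - \<alpha>"
proof -
  obtain ts L where sorted: "sorted_wrt (<) ts" and sub: "set ts \<subseteq> {\<alpha>..\<beta>}"
    and P: "P = circle_point c 1 ` set ts" and "L > 0"
    and arc: "\<And>i. Suc i < length ts \<Longrightarrow> arc_length (circle_point c 1) (ts ! i) (ts ! Suc i) = L"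
    using assms unfolding equidistant_on_arc_def by blast
  have step: "ts ! Suc i = ts ! i + L" if "Suc i < length ts" for i
  proof -
    have "ts ! i < ts ! Suc i"
      using sorted that by (simp add: sorted_wrt_nth_less)
    then show ?thesis
      using arc[OF that] by (simp add: arc_length_circle_point)
  qed
  have nth: "ts ! i = ts ! 0 + real i * L" if "i < length ts" for i
    using that by (induction i) (auto simp: step algebra_simps)
  show thesis
  proof
    show "L > 0" by fact
    have "set ts = (!) ts ` {..<length ts}"
      by (auto simp: set_conv_nth)
    also have "\<dots> = (\<lambda>i. ts ! 0 + real i * L) ` {..<length ts}"
      using nth by (intro image_cong) auto
    \<comment> \<open>Starting one step before the first angle makes the indices run from 1, which
      keeps 0 free for the centre.\<close>
    also have "\<dots> = (\<lambda>j. (ts ! 0 - L) + real j * L) ` Suc ` {..<length ts}"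
      by (simp add: image_image algebra_simps)
    also have "Suc ` {..<length ts} = {1..length ts}"
      by (simp add: image_Suc_lessThan)
    finally show "P = (\<lambda>j. circle_point c 1 ((ts ! 0 - L) + real j * L)) ` {1..length ts}"
      by (simp add: P image_image)
    show "real k * L \<le> \<beta> - \<alpha>" if "k < length ts" for k
    proof -
      have "ts ! k \<in> {\<alpha>..\<beta>}" "ts ! 0 \<in> {\<alpha>..\<beta>}"
        using that by (intro subsetD[OF sub] nth_mem; linarith)+
      then show ?thesis
        using nth[OF that] by auto
    qed
  qed
qed

section \<open>Distances and multiplicities through an indexing of the points\<close>

lemma distances_image:
  fixes q :: "'i::linorder \<Rightarrow> 'a::metric_space"
  assumes "inj_on q I"
  shows "distances (q ` I) = {dist (q i) (q j) | i j. i \<in> I \<and> j \<in> I \<and> i < j}"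
proof (intro equalityI subsetI)
  fix d assume "d \<in> distances (q ` I)"
  then obtain i j where "i \<in> I" "j \<in> I" "q i \<noteq> q j" "d = dist (q i) (q j)"
    unfolding distances_def by blast
  then show "d \<in> {dist (q i) (q j) | i j. i \<in> I \<and> j \<in> I \<and> i < j}"
    by (cases i j rule: linorder_cases) (use dist_commute in blast)+
next
  fix d assume "d \<in> {dist (q i) (q j) | i j. i \<in> I \<and> j \<in> I \<and> i < j}"
  then obtain i j where "i \<in> I" "j \<in> I" "i < j" "d = dist (q i) (q j)"
    by blast
  moreover from this have "q i \<noteq> q j"
    using assms by (auto dest: inj_onD)
  ultimately show "d \<in> distances (q ` I)"
    unfolding distances_def by blast
qed

text \<open>The order on indices picks one of the two orderings of each unordered pair, and
  injectivity of \<open>q\<close> makes this a bijection, so counting pairs of points becomes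
  counting pairs of indices.\<close>

lemma distance_multiplicity_image:
  fixes q :: "'i::linorder \<Rightarrow> 'a::metric_space"
  assumes inj: "inj_on q I"
  shows "distance_multiplicity (q ` I) d
    = card {(i, j). i \<in> I \<and> j \<in> I \<and> i < j \<and> dist (q i) (q j) = d}" (is "_ = card ?S")
proof -
  have "{{x, y} | x y. x \<in> q ` I \<and> y \<in> q ` I \<and> x \<noteq> y \<and> dist x y = d}
      = (\<lambda>(i, j). {q i, q j}) ` ?S" (is "?A = _")
  proof (intro equalityI subsetI)
    fix e assume "e \<in> ?A"
    then obtain i j where ij: "i \<in> I" "j \<in> I" "q i \<noteq> q j" "dist (q i) (q j) = d" "e = {q i, q j}"
      by blast
    show "e \<in> (\<lambda>(i, j). {q i, q j}) ` ?S"
    proof (cases "i < j")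
      case True
      then show ?thesis using ij by force
    next
      case False
      then have "j < i" using ij by (metis linorder_neqE)
      then have "(j, i) \<in> ?S" using ij by (simp add: dist_commute)
      then show ?thesis using ij by (force simp: insert_commute)
    qed
  next
    fix e assume "e \<in> (\<lambda>(i, j). {q i, q j}) ` ?S"
    then obtain i j where ij: "i \<in> I" "j \<in> I" "i < j" "dist (q i) (q j) = d" "e = {q i, q j}"
      by auto
    moreover from this have "q i \<noteq> q j"
      using inj by (auto dest: inj_onD)
    ultimately show "e \<in> ?A" by blast
  qed
  moreover have "inj_on (\<lambda>(i, j). {q i, q j}) ?S"
    by (auto simp: inj_on_def doubleton_eq_iff inj_on_eq_iff[OF inj])
  ultimately show ?thesis
    by (simp add: distance_multiplicity_def card_image)
qed

text \<open>As \<open>d\<close> lists each distance once, the multiset of multiplicities consists of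
  the numbers \<open>m - k\<close> for \<open>k < m\<close>, that is, of 1 to \<open>m\<close> once
  each. Sorting discards the order of the distances, so \<open>d\<close> need not be
  monotone.\<close>

lemma distance_multiplicities_eqI:
  assumes "distances X = d ` {..<m}" "inj_on d {..<m}"
    and mult: "\<And>k. k < m \<Longrightarrow> distance_multiplicity X (d k) = m - k"
  shows "distance_multiplicities X = rev [1..<Suc m]"
proof -
  have "image_mset (distance_multiplicity X) (mset_set (distances X))
      = image_mset (\<lambda>k. distance_multiplicity X (d k)) (mset_set {..<m})"
    by (simp add: assms(1) flip: image_mset_mset_set[OF assms(2)])
      (simp add: multiset.map_comp comp_def)
  also have "\<dots> = image_mset (\<lambda>k. m - k) (mset_set {..<m})"
    using mult by (intro image_mset_cong) auto
  also have "\<dots> = mset_set ((\<lambda>k. m - k) ` {..<m})"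
    by (intro image_mset_mset_set) (auto simp: inj_on_def)
  also have "(\<lambda>k. m - k) ` {..<m} = {1..<Suc m}"
  proof (intro equalityI subsetI)
    fix j assume "j \<in> {1..<Suc m}"
    then have "j = m - (m - j)" "m - j \<in> {..<m}"
      by auto
    then show "j \<in> (\<lambda>k. m - k) ` {..<m}"
      by (rule image_eqI)
  qed auto
  also have "mset_set {1..<Suc m} = mset [1..<Suc m]"
    by (simp only: mset_upt)
  finally show ?thesis
    by (simp add: distance_multiplicities_def sorted_list_of_multiset_mset
        sorted_sort_id del: upt_Suc)
qed

theorem mainTheorem9:
  fixes c :: "real^2" and C \<gamma> P X :: "(real^2) set" and \<alpha> \<beta> :: real and n :: nat
  assumes "C = sphere c 1"
    and "\<gamma> = circular_arc c 1 \<alpha> \<beta>" and "\<gamma> \<subseteq> C"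
    and "\<alpha> < \<beta>" and "\<beta> - \<alpha> < pi / 3"
    and "n \<ge> 1"
    and "P \<subseteq> \<gamma>" and "card P = n - 1" and "equidistant_on_arc c 1 \<alpha> \<beta> P"
    and "X = insert c P"
  shows "distance_multiplicities X = rev [1..<n]"
proof -
  obtain a L m where "L > 0"
    and P: "P = (\<lambda>j. circle_point c 1 (a + real j * L)) ` {1..m}"
    and "\<And>k. k < m \<Longrightarrow> real k * L \<le> \<beta> - \<alpha>"
    using assms(9) by (rule equidistant_on_arc_progression) (rule that)
  with assms(5) have bound: "real k * L < pi / 3" if "k < m" for k
    using that by force
  define q where "q j = (if j = 0 then c else circle_point c 1 (a + real j * L))" for j
  define d where "d k = (if k = 0 then 1 else 2 * sin (real k * L / 2))" for k
  \<comment> \<open>For \<open>i < j\<close>, \<open>d (diff i j)\<close> is to be the distance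
    between the points \<open>i\<close> and \<open>j\<close>. Two points of the arc have index
    difference at least 1, so the value 0 is free to stand for the radius.\<close>
  define diff where "diff i j = (if i = 0 then 0 else j - i)" for i j :: nat
  have d_pos: "d k > 0" if "k < m" for k
  proof (cases "k = 0")
    case False
    have "sin (real k * L / 2) > 0"
    proof (rule sin_gt_zero)
      show "0 < real k * L / 2" using False \<open>L > 0\<close> by simp
      show "real k * L / 2 < pi" using bound[OF that] pi_gt_zero by linarith
    qed
    then show ?thesis
      using False by (simp add: d_def)
  qed (simp add: d_def)
  have d_less_1: "d k < 1" if "0 < k" "k < m" for k
  proof -
    have "0 < real k * L"
      using that \<open>L > 0\<close> by simp
    \<comment> \<open>Here the bound \<open>pi / 3\<close> enters: a chord of that central angle
      equals the radius, so every chord within the arc is shorter than 1.\<close>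
    then have "sin (real k * L / 2) < sin (pi / 6)"
      using bound[OF that(2)] pi_gt_zero by (intro sin_monotone_2pi) linarith+
    then show ?thesis
      using that by (simp add: d_def sin_30)
  qed
  have inj_d: "inj_on d {..<m}"
  proof (rule linorder_inj_onI)
    fix k l assume "k < l" "k \<in> {..<m}" "l \<in> {..<m}"
    show "d k \<noteq> d l"
    proof (cases "k = 0")
      case True
      then show ?thesis
        using d_less_1[of l] \<open>k < l\<close> \<open>l \<in> {..<m}\<close> by (auto simp: d_def)
    next
      case False
      have "0 \<le> real k * L" "real k * L < real l * L"
        using \<open>L > 0\<close> \<open>k < l\<close> by simp_all
      then have "sin (real k * L / 2) < sin (real l * L / 2)"
        using bound[of l] \<open>l \<in> {..<m}\<close> pi_gt_zero by (intro sin_monotone_2pi) auto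
      then show ?thesis
        using False \<open>k < l\<close> by (simp add: d_def)
    qed
  qed auto
  have diff_less: "diff i j < m" if "i < j" "j \<le> m" for i j
    using that by (auto simp: diff_def)
  have dist_q: "dist (q i) (q j) = d (diff i j)" if "i < j" "j \<le> m" for i j
  proof (cases "i = 0")
    case True
    then show ?thesis
      using that by (simp add: q_def d_def diff_def dist_circle_point_center)
  next
    case False
    then have "dist (q i) (q j) = \<bar>2 * sin (real (j - i) * L / 2)\<bar>"
      using that by (simp add: q_def dist_circle_point algebra_simps abs_mult)
    also have "\<dots> = \<bar>d (diff i j)\<bar>"
      using that False by (simp add: d_def diff_def)
    finally show ?thesis
      using d_pos[OF diff_less[OF that]] by simp
  qed
  have inj_q: "inj_on q {..m}"
  proof (rule linorder_inj_onI)
    fix i j assume "i < j" "i \<in> {..m}" "j \<in> {..m}"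
    \<comment> \<open>Distinct indices give a positive distance, which separates the centre from the
      arc and the points of the arc from each other.\<close>
    then have "dist (q i) (q j) > 0"
      using d_pos[OF diff_less] by (simp add: dist_q)
    then show "q i \<noteq> q j" by auto
  qed auto
  have P_q: "P = q ` {1..m}"
    unfolding P by (intro image_cong) (auto simp: q_def)
  \<comment> \<open>So far \<open>m\<close> is only the number of indices; injectivity of
    \<open>q\<close> ties it to \<open>n\<close>.\<close>
  have "card P = m"
    unfolding P_q by (subst card_image) (auto intro: inj_on_subset[OF inj_q])
  then have n: "n = Suc m"
    using assms(6,8) by simp
  have "{..m} = insert 0 {1..m}" "q 0 = c"
    by (auto simp: q_def)
  then have X: "X = q ` {..m}"
    by (simp only: assms(10) P_q image_insert)
  show ?thesis
    unfolding n
  proof (rule distance_multiplicities_eqI[OF _ inj_d])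
    have "d k \<in> distances X" if "k < m" for k
    proof -
      \<comment> \<open>The pair ending at \<open>Suc k\<close> realizes \<open>d k\<close>: it
        starts at the centre for the radius and at the first point of the arc for a chord.\<close>
      define i :: nat where "i = (if k = 0 then 0 else 1)"
      have "i < Suc k" "Suc k \<le> m" "diff i (Suc k) = k"
        using that by (auto simp: i_def diff_def)
      then have "d k = dist (q i) (q (Suc k)) \<and> i \<in> {..m} \<and> Suc k \<in> {..m} \<and> i < Suc k"
        using dist_q[of i "Suc k"] by simp
      then show ?thesis
        unfolding X distances_image[OF inj_q] by blast
    qed
    moreover have "dist (q i) (q j) \<in> d ` {..<m}" if "i < j" "j \<le> m" for i j
      using diff_less[OF that] unfolding dist_q[OF that] by simp
    then have "distances X \<subseteq> d ` {..<m}"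
      unfolding X distances_image[OF inj_q] by auto
    ultimately show "distances X = d ` {..<m}"
      by auto
  next
    fix k assume "k < m"
    have "distance_multiplicity X (d k) = card {(i, j). i < j \<and> j \<le> m \<and> diff i j = k}"
    proof -
      \<comment> \<open>Injectivity of \<open>d\<close> turns equality of distances into equality of
        index differences.\<close>
      have "d (diff i j) = d k \<longleftrightarrow> diff i j = k" if "i < j" "j \<le> m" for i j
        using diff_less[OF that] \<open>k < m\<close> by (simp add: inj_on_eq_iff[OF inj_d])
      then show ?thesis
        unfolding X distance_multiplicity_image[OF inj_q]
        by (intro arg_cong[of _ _ card]) (auto simp: dist_q)
    qed
    \<comment> \<open>For \<open>k = 0\<close> only pairs with the centre occur, \<open>m\<close> in
      number. For \<open>k > 0\<close> the first index \<open>i\<close> is at least 1 and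
      \<open>i + k \<le> m\<close>, which leaves \<open>m - k\<close> choices.\<close>
    also have "{(i, j). i < j \<and> j \<le> m \<and> diff i j = k}
        = (if k = 0 then Pair 0 ` {1..m} else (\<lambda>i. (i, i + k)) ` {1..m - k})"
      by (auto simp: diff_def split: if_splits)
    also have "card \<dots> = m - k"
      by (simp add: card_image inj_on_def)
    finally show "distance_multiplicity X (d k) = m - k" .
  qed
qed

end
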